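(* Let $H$ be a bounded hoop algebra and $s:H\to H$ a square root on $H$. Suppose that $H$ is finite or that $H$ satisfies the ascending chain condition. Then: (i) If $H$ is a $\vee$-hoop with the double negation property, then $H$ is a Boolean algebra. (ii) If $H$ is totally ordered, then $H$ has the structure of a Gödel algebra, that is, for all $x,y\in H$, $x\odot y=\min(x,y)$, and $x\rightarrow y=1$ if $x\le y$ while $x\rightarrow y=y$ if $x>y$.
   Context: A hoop algebra is an algebra $(H;\odot,\rightarrow,1)$ of type $(2,2,0)$ such that $(H;\odot,1)$ is a commutative monoid and, for all $x,y,z\in H$: $x\rightarrow x=1$; $x\odot(x\rightarrow y)=y\odot(y\rightarrow x)$; $(x\odot y)\rightarrow z=x\rightarrow(y\rightarrow z)$. It is partially ordered by $x\le y$ iff $x\rightarrow y=1$, and is a meet-semilattice with $x\wedge y=x\odot(x\rightarrow y)$. $H$ is bounded if it has a least element $0$; then $x':=x\rightarrow 0$. The double negation property (DNP) means $x''=x$ for all $x\in H$. Put $x\vee y:=((x\rightarrow y)\rightarrow y)\wedge((y\rightarrow x)\rightarrow x)$; $H$ is a $\vee$-hoop if $\vee$ is the join operation for $\le$. A square root on $H$ is a map $s:H\to H$ such that (1) $s(x)\odot s(x)=x$ for every $x\in H$; (2) for all $x,y\in H$, if $y\odot y\le x$ then $y\le s(x)$. $H$ satisfies the ascending chain condition if for every sequence $x_1\le x_2\le\cdots$ in $H$ there is $k$ with $x_i=x_k$ for all $i\ge k$. "$H$ is a Boolean algebra" means that $(H;\vee,\wedge,{}',0,1)$ is a Boolean algebra.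 *)

theory Defs
  imports Main
begin

text \<open>
  The carrier of a hoop algebra is the whole type \<open>'a\<close>; an arbitrary hoop algebra is one on
  an arbitrary type.  The operations are parameters rather than class operations, so
  that no order on \<open>'a\<close> other than the one derived from the residuum is involved.
\<close>

locale hoop_algebra = comm_monoid mult one
  for mult :: "'a \<Rightarrow> 'a \<Rightarrow> 'a" (infixl "\<^bold>\<odot>" 70)
    and one :: "'a" ("\<^bold>1") +
  fixes imp :: "'a \<Rightarrow> 'a \<Rightarrow> 'a" (infixr "\<^bold>\<rightarrow>" 65)
  assumes imp_self: "x \<^bold>\<rightarrow> x = \<^bold>1"
    and divisibility: "x \<^bold>\<odot> (x \<^bold>\<rightarrow> y) = y \<^bold>\<odot> (y \<^bold>\<rightarrow> x)"
    and mult_imp: "(x \<^bold>\<odot> y) \<^bold>\<rightarrow> z = x \<^bold>\<rightarrow> (y \<^bold>\<rightarrow> z)"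
begin

definition le :: "'a \<Rightarrow> 'a \<Rightarrow> bool" (infix "\<^bold>\<le>" 50)
  where "x \<^bold>\<le> y \<longleftrightarrow> x \<^bold>\<rightarrow> y = \<^bold>1"

definition less :: "'a \<Rightarrow> 'a \<Rightarrow> bool" (infix "\<^bold><" 50)
  where "x \<^bold>< y \<longleftrightarrow> x \<^bold>\<le> y \<and> x \<noteq> y"

definition meet :: "'a \<Rightarrow> 'a \<Rightarrow> 'a" (infixl "\<^bold>\<sqinter>" 70)
  where "x \<^bold>\<sqinter> y = x \<^bold>\<odot> (x \<^bold>\<rightarrow> y)"

definition join :: "'a \<Rightarrow> 'a \<Rightarrow> 'a" (infixl "\<^bold>\<squnion>" 65)
  where "x \<^bold>\<squnion> y = ((x \<^bold>\<rightarrow> y) \<^bold>\<rightarrow> y) \<^bold>\<sqinter> ((y \<^bold>\<rightarrow> x) \<^bold>\<rightarrow> x)"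

definition join_hoop :: bool
  where "join_hoop \<longleftrightarrow>
    (\<forall>x y. x \<^bold>\<le> x \<^bold>\<squnion> y \<and> y \<^bold>\<le> x \<^bold>\<squnion> y \<and> (\<forall>z. x \<^bold>\<le> z \<and> y \<^bold>\<le> z \<longrightarrow> x \<^bold>\<squnion> y \<^bold>\<le> z))"

definition totally_ordered :: bool
  where "totally_ordered \<longleftrightarrow> (\<forall>x y. x \<^bold>\<le> y \<or> y \<^bold>\<le> x)"

definition square_root :: "('a \<Rightarrow> 'a) \<Rightarrow> bool"
  where "square_root s \<longleftrightarrow>
    (\<forall>x. s x \<^bold>\<odot> s x = x) \<and> (\<forall>x y. y \<^bold>\<odot> y \<^bold>\<le> x \<longrightarrow> y \<^bold>\<le> s x)"

definition ascending_chain_condition :: bool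
  where "ascending_chain_condition \<longleftrightarrow>
    (\<forall>x :: nat \<Rightarrow> 'a. (\<forall>i. x i \<^bold>\<le> x (Suc i)) \<longrightarrow> (\<exists>k. \<forall>i\<ge>k. x i = x k))"

definition goedel_structure :: bool
  where "goedel_structure \<longleftrightarrow>
    (\<forall>x y. x \<^bold>\<odot> y = ord.min le x y \<and>
      (x \<^bold>\<le> y \<longrightarrow> x \<^bold>\<rightarrow> y = \<^bold>1) \<and> (y \<^bold>< x \<longrightarrow> x \<^bold>\<rightarrow> y = y))"

lemma one_imp: "\<^bold>1 \<^bold>\<rightarrow> x = x"
proof -
  have eq: "\<^bold>1 \<^bold>\<rightarrow> y = y \<^bold>\<odot> (y \<^bold>\<rightarrow> \<^bold>1)" for y
    using divisibility[of "\<^bold>1" y] by simp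
  define a b where "a = x \<^bold>\<rightarrow> \<^bold>1" and "b = \<^bold>1 \<^bold>\<rightarrow> x"
  have b: "b = x \<^bold>\<odot> a"
    by (simp add: a_def b_def eq)
  have a: "a \<^bold>\<odot> (a \<^bold>\<rightarrow> \<^bold>1) = a"
    by (metis a_def eq mult_imp left_neutral)
  have "x \<^bold>\<rightarrow> b = \<^bold>1"
    using mult_imp[of x "\<^bold>1" x] by (simp add: b_def imp_self)
  moreover have "b \<^bold>\<rightarrow> x = a \<^bold>\<rightarrow> \<^bold>1"
    using mult_imp[of a x x] by (simp add: b imp_self commute)
  ultimately have "x = b \<^bold>\<odot> (a \<^bold>\<rightarrow> \<^bold>1)"
    using divisibility[of x b] by simp
  also have "\<dots> = b"
    using a by (simp add: b assoc)
  finally show ?thesis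
    by (simp add: b_def)
qed

lemma imp_one: "x \<^bold>\<rightarrow> \<^bold>1 = \<^bold>1"
proof -
  have "x \<^bold>\<odot> (x \<^bold>\<rightarrow> \<^bold>1) = x"
    using divisibility[of x "\<^bold>1"] by (simp add: one_imp)
  then have "x \<^bold>\<rightarrow> \<^bold>1 = (x \<^bold>\<rightarrow> \<^bold>1) \<^bold>\<rightarrow> (x \<^bold>\<rightarrow> \<^bold>1)"
    by (metis commute mult_imp)
  then show ?thesis
    by (simp add: imp_self)
qed

lemma mult_le: "x \<^bold>\<odot> y \<^bold>\<le> x"
  using mult_imp[of y x x] by (simp add: le_def commute imp_self imp_one)

lemma le_factor: "x \<^bold>\<le> y \<Longrightarrow> y \<^bold>\<odot> (y \<^bold>\<rightarrow> x) = x"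
  using divisibility[of x y] by (simp add: le_def)

lemma le_trans: "x \<^bold>\<le> z" if "x \<^bold>\<le> y" and "y \<^bold>\<le> z"
  using le_factor[OF that(1)] that(2) by (metis le_def commute mult_imp imp_one)

lemma le_antisym: "x \<^bold>\<le> y \<Longrightarrow> y \<^bold>\<le> x \<Longrightarrow> x = y"
  using divisibility[of x y] by (simp add: le_def)

sublocale ordering_top le less "\<^bold>1"
proof
  show "x \<^bold>\<le> x" for x
    by (simp add: le_def imp_self)
  show "x \<^bold>\<le> y \<Longrightarrow> y \<^bold>\<le> z \<Longrightarrow> x \<^bold>\<le> z" for x y z
    by (rule le_trans)
  show "x \<^bold>< y \<longleftrightarrow> x \<^bold>\<le> y \<and> x \<noteq> y" for x y
    by (rule less_def)
  show "x \<^bold>\<le> y \<Longrightarrow> y \<^bold>\<le> x \<Longrightarrow> x = y" for x y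
    by (rule le_antisym)
  show "x \<^bold>\<le> \<^bold>1" for x
    by (simp add: le_def imp_one)
qed

lemma meet_le1: "x \<^bold>\<sqinter> y \<^bold>\<le> x"
  by (simp add: meet_def mult_le)

lemma meet_le2: "x \<^bold>\<sqinter> y \<^bold>\<le> y"
  by (simp add: meet_def divisibility[of x y] mult_le)

lemma meet_greatest: "z \<^bold>\<le> x \<^bold>\<sqinter> y" if "z \<^bold>\<le> x" and "z \<^bold>\<le> y"
proof -
  have z: "x \<^bold>\<odot> (x \<^bold>\<rightarrow> z) = z"
    using that(1) by (rule le_factor)
  have "x \<^bold>\<rightarrow> z \<^bold>\<le> x \<^bold>\<rightarrow> y"
    using mult_imp[of "x \<^bold>\<rightarrow> z" x y] that(2) z by (simp add: le_def commute)
  from le_factor[OF this] z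
  have "z = (x \<^bold>\<sqinter> y) \<^bold>\<odot> ((x \<^bold>\<rightarrow> y) \<^bold>\<rightarrow> (x \<^bold>\<rightarrow> z))"
    by (simp add: meet_def assoc)
  then show ?thesis
    using mult_le by metis
qed

end

locale bounded_hoop_algebra = hoop_algebra +
  fixes zero :: "'a" ("\<^bold>0")
  assumes zero_least: "\<^bold>0 \<^bold>\<le> x"
begin

definition neg :: "'a \<Rightarrow> 'a"
  where "neg x = x \<^bold>\<rightarrow> \<^bold>0"

definition double_negation :: bool
  where "double_negation \<longleftrightarrow> (\<forall>x. neg (neg x) = x)"

end
end

(* The iterates x, s x, s (s x), ... form an ascending chain whose consecutive terms are linked by
   squaring.  Once the chain is stationary its limit is idempotent, so squaring back down shows that
   the limit is x itself.  Hence every element is idempotent, multiplication is the meet, and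
   residuation makes the hoop a Heyting structure. *)
theory Submission
  imports Defs
begin

context hoop_algebra
begin

text \<open>The axiom \<open>mult_imp\<close> is this adjunction in equational form: since the order
  is read off from the residuum, both sides say that the same element equals
  \<open>one\<close>.\<close>

lemma residuation: "x \<^bold>\<odot> y \<^bold>\<le> z \<longleftrightarrow> x \<^bold>\<le> y \<^bold>\<rightarrow> z"
  by (simp add: le_def mult_imp)

lemma mult_mono: "u \<^bold>\<odot> v \<^bold>\<le> x \<^bold>\<odot> y" if "u \<^bold>\<le> x" and "v \<^bold>\<le> y"
proof -
  \<comment> \<open>Residuating b \<odot> c \<le> b \<odot> c puts b, hence a, below the residuum of
    c into b \<odot> c; residuating back gives the claim.\<close>
  have mono1: "a \<^bold>\<odot> c \<^bold>\<le> b \<^bold>\<odot> c" if "a \<^bold>\<le> b" for a b c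
    by (metis refl residuation le_trans that)
  show ?thesis
    using mono1[OF that(1), of v] mono1[OF that(2), of x] by (metis commute le_trans)
qed

text \<open>By the pigeonhole principle some value of the chain recurs infinitely often, and
  monotonicity leaves no room for other values between two recurrences.\<close>

lemma finite_imp_ascending_chain_condition:
  assumes "finite (UNIV :: 'a set)"
  shows ascending_chain_condition
  unfolding ascending_chain_condition_def
proof (intro allI impI)
  fix x :: "nat \<Rightarrow> 'a"
  assume step: "\<forall>i. x i \<^bold>\<le> x (Suc i)"
  have mono: "x i \<^bold>\<le> x j" if "i \<le> j" for i j
    using that
  proof (induction rule: dec_induct)
    case (step n)
    show ?case
      by (rule le_trans[OF step.IH \<open>\<forall>i. x i \<^bold>\<le> x (Suc i)\<close>[rule_format]])
  qed (rule refl)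
  have "finite (range x)"
    by (rule finite_subset[OF subset_UNIV assms])
  then obtain k where inf: "infinite {j. x j = x k}"
    using pigeonhole_infinite[of "UNIV :: nat set" x] by auto
  have "x i = x k" if "k \<le> i" for i
  proof -
    \<comment> \<open>An infinite set of indices is unbounded, so the value \<open>x k\<close>
      recurs at or after i, and \<open>x i\<close> is squeezed between \<open>x k\<close> and
      \<open>x j\<close>.\<close>
    obtain j where "i \<le> j" "x j = x k"
      using inf unfolding finite_nat_set_iff_bounded by (auto simp: not_less)
    then show ?thesis
      using mono[OF that] mono[of i j] le_antisym by simp
  qed
  then show "\<exists>k. \<forall>i\<ge>k. x i = x k"
    by blast
qed

lemma idempotent_of_square_root:
  assumes root: "square_root s" and acc: ascending_chain_condition
  shows "x \<^bold>\<odot> x = x"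
proof -
  have square: "s y \<^bold>\<odot> s y = y" for y
    using root by (simp add: square_root_def)
  \<comment> \<open>The square of y lies below y, so y competes in the maximality clause for
    \<open>s y\<close>.\<close>
  have "y \<^bold>\<le> s y" for y
    using root mult_le[of y y] by (simp add: square_root_def)
  then have "\<forall>i. (s ^^ i) x \<^bold>\<le> (s ^^ Suc i) x"
    by simp
  then obtain k where k: "\<forall>i\<ge>k. (s ^^ i) x = (s ^^ k) x"
    using acc[unfolded ascending_chain_condition_def, rule_format, of "\<lambda>i. (s ^^ i) x"] by blast
  define t where "t = (s ^^ k) x"
  have "s t = t"
    using k[rule_format, of "Suc k"] by (simp add: t_def)
  then have idem: "t \<^bold>\<odot> t = t"
    using square[of t] by simp
  \<comment> \<open>The fixed t is kept while n varies, so that the induction can peel off one s at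
    a time: squaring both sides turns iterate n + 1 into iterate n and leaves t unchanged.\<close>
  have "(s ^^ n) x = t \<Longrightarrow> x = t" for n
  proof (induction n)
    case (Suc n)
    then have "(s ^^ n) x = t"
      using square[of "(s ^^ n) x"] idem by simp
    with Suc.IH show ?case .
  qed simp
  then have "x = t"
    by (simp add: t_def)
  with idem show ?thesis by simp
qed

lemma mult_eq_meet:
  assumes "\<And>x. x \<^bold>\<odot> x = x"
  shows "x \<^bold>\<odot> y = x \<^bold>\<sqinter> y"
proof (rule le_antisym)
  show "x \<^bold>\<odot> y \<^bold>\<le> x \<^bold>\<sqinter> y"
    by (rule meet_greatest) (rule mult_le, subst commute, rule mult_le)
  show "x \<^bold>\<sqinter> y \<^bold>\<le> x \<^bold>\<odot> y"
    \<comment> \<open>The meet equals its own square, and its two factors are bounded by x and y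
      respectively.\<close>
    using mult_mono[OF meet_le1[of x y] meet_le2[of x y]] by (simp add: assms)
qed

lemma goedel_structure_of_idempotent:
  assumes idem: "\<And>x. x \<^bold>\<odot> x = x" and total: totally_ordered
  shows goedel_structure
proof -
  have min: "x \<^bold>\<odot> y = ord.min le x y" for x y
  proof (cases "x \<^bold>\<le> y")
    case True
    then have "x \<^bold>\<odot> y = x"
      using mult_eq_meet[OF idem, of x y] by (simp add: meet_def le_def)
    with True show ?thesis by (simp add: ord.min_def)
  next
    case False
    then have "y \<^bold>\<le> x"
      using total by (auto simp: totally_ordered_def)
    then have "x \<^bold>\<odot> y = y"
      using mult_eq_meet[OF idem, of x y] by (simp add: meet_def divisibility[of x y] le_def)
    with False show ?thesis by (simp add: ord.min_def)
  qed
  moreover have "x \<^bold>\<rightarrow> y = y" if "y \<^bold>< x" for x y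
  proof -
    \<comment> \<open>Divisibility says that x times the residuum is y, and the product is a
      minimum. As y differs from x, the minimum must be attained at the residuum.\<close>
    have "ord.min le x (x \<^bold>\<rightarrow> y) = y"
      using that le_factor[of y x] by (simp add: min less_def)
    with that show ?thesis
      by (auto simp: ord.min_def less_def split: if_splits)
  qed
  ultimately show ?thesis
    by (simp add: goedel_structure_def le_def)
qed

end

context bounded_hoop_algebra
begin

text \<open>Multiplication is the meet and has a residual, so it preserves joins, which gives
  distributivity; double negation supplies excluded middle.\<close>

lemma abstract_boolean_algebra_of_idempotent:
  assumes idem: "\<And>x. x \<^bold>\<odot> x = x" and jh: join_hoop and dn: double_negation
  shows "abstract_boolean_algebra meet join neg \<^bold>0 \<^bold>1"
proof -
  have meet_mult: "x \<^bold>\<sqinter> y = x \<^bold>\<odot> y" for x y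
    by (simp add: mult_eq_meet[OF idem])
  have join1: "x \<^bold>\<le> x \<^bold>\<squnion> y" and join2: "y \<^bold>\<le> x \<^bold>\<squnion> y" for x y
    using jh by (simp_all add: join_hoop_def)
  have join_least: "x \<^bold>\<squnion> y \<^bold>\<le> z" if "x \<^bold>\<le> z" "y \<^bold>\<le> z" for x y z
    using jh that by (simp add: join_hoop_def)
  have join_commute: "x \<^bold>\<squnion> y = y \<^bold>\<squnion> x" for x y
    by (intro le_antisym join_least join1 join2)
  have join_assoc: "x \<^bold>\<squnion> y \<^bold>\<squnion> z = x \<^bold>\<squnion> (y \<^bold>\<squnion> z)" for x y z
    by (intro le_antisym join_least)
      (rule join1 join2 le_trans[OF join1 join1] le_trans[OF join2 join1]
        le_trans[OF join1 join2] le_trans[OF join2 join2])+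
  have distrib: "x \<^bold>\<odot> (y \<^bold>\<squnion> z) = x \<^bold>\<odot> y \<^bold>\<squnion> x \<^bold>\<odot> z" for x y z
  proof (rule le_antisym)
    \<comment> \<open>Moving x across the adjunction leaves a bare join on the left, where the least
      upper bound property applies.\<close>
    have "y \<^bold>\<squnion> z \<^bold>\<le> x \<^bold>\<rightarrow> (x \<^bold>\<odot> y \<^bold>\<squnion> x \<^bold>\<odot> z)"
      by (intro join_least; subst residuation[symmetric], subst commute) (rule join1 join2)+
    then show "x \<^bold>\<odot> (y \<^bold>\<squnion> z) \<^bold>\<le> x \<^bold>\<odot> y \<^bold>\<squnion> x \<^bold>\<odot> z"
      by (subst commute) (simp only: residuation)
    show "x \<^bold>\<odot> y \<^bold>\<squnion> x \<^bold>\<odot> z \<^bold>\<le> x \<^bold>\<odot> (y \<^bold>\<squnion> z)"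
      by (intro join_least mult_mono refl join1 join2)
  qed
  have absorb: "x \<^bold>\<squnion> x \<^bold>\<odot> y = x" for x y
    by (intro le_antisym join_least refl mult_le join1)
  have absorb': "(x \<^bold>\<squnion> y) \<^bold>\<odot> x = x" for x y
    using le_factor[OF join1[of x y]] mult_eq_meet[OF idem, of "x \<^bold>\<squnion> y" x]
    by (simp add: meet_def)
  have dual_distrib: "x \<^bold>\<squnion> y \<^bold>\<odot> z = (x \<^bold>\<squnion> y) \<^bold>\<odot> (x \<^bold>\<squnion> z)" for x y z
  proof -
    \<comment> \<open>The dual law follows from the first by expanding the product twice and
      absorbing.\<close>
    have "(x \<^bold>\<squnion> y) \<^bold>\<odot> (x \<^bold>\<squnion> z) = x \<^bold>\<squnion> (z \<^bold>\<odot> x \<^bold>\<squnion> z \<^bold>\<odot> y)"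
      by (simp only: distrib absorb' commute[of "x \<^bold>\<squnion> y" z])
    also have "\<dots> = (x \<^bold>\<squnion> x \<^bold>\<odot> z) \<^bold>\<squnion> y \<^bold>\<odot> z"
      by (simp only: join_assoc commute[of z])
    finally show ?thesis by (simp add: absorb)
  qed
  have contradiction: "x \<^bold>\<odot> neg x = \<^bold>0" for x
    unfolding neg_def by (rule le_factor) (rule zero_least)
  have excluded_middle: "x \<^bold>\<squnion> neg x = \<^bold>1" for x
  proof -
    define u where "u = x \<^bold>\<squnion> neg x"
    have antimono: "neg b \<^bold>\<le> neg a" if "a \<^bold>\<le> b" for a b
    proof -
      have "neg b \<^bold>\<odot> a \<^bold>\<le> \<^bold>0"
        using mult_mono[OF refl that, of "neg b"] contradiction[of b] by (simp add: commute)
      then show ?thesis by (simp add: residuation neg_def)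
    qed
    \<comment> \<open>Since u bounds both x and \<open>neg x\<close>, its negation lies below
      \<open>neg x\<close> and \<open>neg (neg x)\<close>, whose product is \<open>zero\<close>.
      Idempotence then forces \<open>neg u\<close> to be \<open>zero\<close>, and negating once more
      yields u = 1.\<close>
    have "neg u \<^bold>\<odot> neg u \<^bold>\<le> neg x \<^bold>\<odot> neg (neg x)"
      unfolding u_def by (intro mult_mono antimono join1 join2)
    then have "neg u = \<^bold>0"
      using zero_least by (simp add: idem contradiction le_antisym)
    moreover have "neg (neg u) = u"
      using dn by (simp add: double_negation_def)
    ultimately show ?thesis
      by (simp add: u_def neg_def imp_self)
  qed
  show ?thesis
  proof
    show "x \<^bold>\<sqinter> y \<^bold>\<sqinter> z = x \<^bold>\<sqinter> (y \<^bold>\<sqinter> z)" for x y z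
      by (simp add: meet_mult assoc)
    show "x \<^bold>\<sqinter> y = y \<^bold>\<sqinter> x" for x y
      by (simp add: meet_mult commute)
    show "x \<^bold>\<squnion> y \<^bold>\<squnion> z = x \<^bold>\<squnion> (y \<^bold>\<squnion> z)" for x y z
      by (rule join_assoc)
    show "x \<^bold>\<squnion> y = y \<^bold>\<squnion> x" for x y
      by (rule join_commute)
    show "x \<^bold>\<sqinter> (y \<^bold>\<squnion> z) = x \<^bold>\<sqinter> y \<^bold>\<squnion> x \<^bold>\<sqinter> z" for x y z
      by (simp add: meet_mult distrib)
    show "x \<^bold>\<squnion> y \<^bold>\<sqinter> z = (x \<^bold>\<squnion> y) \<^bold>\<sqinter> (x \<^bold>\<squnion> z)" for x y z
      by (simp only: meet_mult dual_distrib)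
    show "x \<^bold>\<sqinter> \<^bold>1 = x" for x
      by (simp add: meet_mult)
    show "x \<^bold>\<squnion> \<^bold>0 = x" for x
      by (intro le_antisym join_least refl zero_least join1)
    show "x \<^bold>\<sqinter> neg x = \<^bold>0" for x
      by (simp only: meet_mult contradiction)
    show "x \<^bold>\<squnion> neg x = \<^bold>1" for x
      by (rule excluded_middle)
  qed
qed

end

theorem theorem4p24:
  fixes mult :: "'a \<Rightarrow> 'a \<Rightarrow> 'a"
    and imp :: "'a \<Rightarrow> 'a \<Rightarrow> 'a"
    and one zero :: 'a
    and s :: "'a \<Rightarrow> 'a"
  assumes "bounded_hoop_algebra mult one imp zero"
    and "hoop_algebra.square_root mult one imp s"
    and "finite (UNIV :: 'a set) \<or> hoop_algebra.ascending_chain_condition one imp"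
  shows "(hoop_algebra.join_hoop mult one imp \<and>
      bounded_hoop_algebra.double_negation imp zero \<longrightarrow>
      abstract_boolean_algebra (hoop_algebra.meet mult imp) (hoop_algebra.join mult imp)
        (bounded_hoop_algebra.neg imp zero) zero one) \<and>
    (hoop_algebra.totally_ordered one imp \<longrightarrow>
      hoop_algebra.goedel_structure mult one imp)"
proof -
  interpret bounded_hoop_algebra mult one imp zero
    by (rule assms(1))
  have "ascending_chain_condition"
    using assms(3) finite_imp_ascending_chain_condition by blast
  then have "mult x x = x" for x
    by (rule idempotent_of_square_root[OF assms(2)])
  then show ?thesis
    using abstract_boolean_algebra_of_idempotent goedel_structure_of_idempotent by blast
qed

end
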